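(* Let $b,m$ be integers larger than $1$, let $S$ be a finite weighted subset of $[\![b]\!]^*$, and let $l=\max\{|w| : n_{S,w}\neq 0\}$. Then there exist $b-1$ proper finite weighted subsets $S_1,S_2,\dots,S_{b-1}$ of $[\![b]\!]^*$ and a sequence $(u_t)_{t\in\mathbf{N}}$ of finite words over the complex numbers such that: (1) $|u_0|=b^l$; (2) $u_{t+1}=u_t\,\phi_{b,m,S_1}(u_t)\,\phi_{b,m,S_2}(u_t)\cdots\phi_{b,m,S_{b-1}}(u_t)$ (concatenation) for all $t\ge 0$; (3) the infinite word $(a_{b,m,S}(n))_{n\in\mathbf{N}}$ equals $\lim_{t\to\infty}u_t$ (i.e. it is the infinite word having every $u_t$ as a prefix).
   Context: Let $b\ge 2$ and $m\ge 2$ be integers, $[\![b]\!]=\{0,1,\dots,b-1\}$, and $[\![b]\!]^*$ the set of finite words over $[\![b]\!]$; a word is written $w=w[1]w[2]\cdots w[|w|]$, with $w'=w[2]\cdots w[|w|]$ and $(w)_b=\sum_{i=1}^{|w|}w[i]b^{|w|-i}$. For a non-negative integer $n$ and a word $w$ containing at least one nonzero letter, $e_{b,w}(n)$ is the number of occurrences of $w$ as a block of consecutive digits in the base-$b$ expansion of $n$ padded with infinitely many leading zeros. A finite weighted subset $S$ of $[\![b]\!]^*$ assigns a real weight $n_{S,w}$ to each word $w$, with only finitely many nonzero weights (and $n_{S,w}=0$ when $w$ consists only of zeros); $e_{b,S}(n)=\sum_w n_{S,w}e_{b,w}(n)$ and $a_{b,m,S}(n)=\exp(2\pi i\,e_{b,S}(n)/m)$.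 $S$ is proper if $n_{S,w}\neq0$ implies $w[1]\neq 0$. Window functions: for a nonempty word $w$ put $\alpha^1_w=(w')_b/b^{|w|-1}$ and $\alpha^2_w=((w')_b+1)/b^{|w|-1}$; for a finite word $v$ of complex numbers, $\phi_{b,m,w}(v)$ is the word of the same length with $\phi_{b,m,w}(v)[j]=e^{2\pi i/m}v[j]$ if $\alpha^1_w|v|<j\le\alpha^2_w|v|$ and $\phi_{b,m,w}(v)[j]=v[j]$ otherwise. For a finite weighted subset $S$, $\phi_{b,m,S}=\prod_{w}(\phi_{b,m,w})^{n_{S,w}}$, i.e. $\phi_{b,m,S}(v)[j]=v[j]\exp\!\big(\tfrac{2\pi i}{m}\sum_{w:\ \alpha^1_w|v|<j\le\alpha^2_w|v|}n_{S,w}\big)$. *)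

theory Defs
  imports Complex_Main
begin

text \<open>Words over the alphabet \<open>{0, ..., b - 1}\<close> are lists of naturals, most significant letter
  first; the weight function of a weighted subset stands for the weighted subset itself.\<close>

type_synonym weighting = "nat list \<Rightarrow> real"

definition word_over :: "nat \<Rightarrow> nat list \<Rightarrow> bool" where
  "word_over b w \<longleftrightarrow> set w \<subseteq> {..<b}"

definition support :: "weighting \<Rightarrow> nat list set" where
  "support S = {w. S w \<noteq> 0}"

text \<open>The last condition covers the empty word, so supports contain only nonempty words.\<close>

definition weighted_subset :: "nat \<Rightarrow> weighting \<Rightarrow> bool" where
  "weighted_subset b S \<longleftrightarrow>
     finite (support S) \<and>
     (\<forall>w\<in>support S. word_over b w) \<and>
     (\<forall>w. set w \<subseteq> {0} \<longrightarrow> S w = 0)"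

definition proper :: "weighting \<Rightarrow> bool" where
  "proper S \<longleftrightarrow> (\<forall>w\<in>support S. hd w \<noteq> 0)"

text \<open>The maximal length of a word of nonzero weight, with value 0 if there is no such word.\<close>

definition max_length :: "weighting \<Rightarrow> nat" where
  "max_length S = (if support S = {} then 0 else Max (length ` support S))"

definition word_value :: "nat \<Rightarrow> nat list \<Rightarrow> nat" where
  "word_value b w = (\<Sum>i<length w. w ! i * b ^ (length w - 1 - i))"

text \<open>The coefficient of \<open>b ^ k\<close> in the base-\<open>b\<close> expansion of \<open>n\<close>; it is 0 for all large \<open>k\<close>,
  which provides the infinitely many leading zeros.\<close>

definition digit :: "nat \<Rightarrow> nat \<Rightarrow> nat \<Rightarrow> nat" where
  "digit b n k = (n div b ^ k) mod b"

text \<open>An occurrence is recorded by the place \<open>k\<close> of its last letter. The set of occurrences is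
  finite whenever \<open>w\<close> has a nonzero letter and \<open>b \<ge> 2\<close>.\<close>

definition occurrences :: "nat \<Rightarrow> nat list \<Rightarrow> nat \<Rightarrow> nat" where
  "occurrences b w n =
     card {k. \<forall>i<length w. w ! i = digit b n (k + (length w - 1 - i))}"

definition weighted_occurrences :: "nat \<Rightarrow> weighting \<Rightarrow> nat \<Rightarrow> real" where
  "weighted_occurrences b S n = (\<Sum>w\<in>support S. S w * real (occurrences b w n))"

definition block_seq :: "nat \<Rightarrow> nat \<Rightarrow> weighting \<Rightarrow> nat \<Rightarrow> complex" where
  "block_seq b m S n =
     exp (2 * of_real pi * \<i> * of_real (weighted_occurrences b S n) / of_nat m)"

definition window_lower :: "nat \<Rightarrow> nat list \<Rightarrow> real" where
  "window_lower b w = real (word_value b (tl w)) / real b ^ (length w - 1)"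

definition window_upper :: "nat \<Rightarrow> nat list \<Rightarrow> real" where
  "window_upper b w = (real (word_value b (tl w)) + 1) / real b ^ (length w - 1)"

text \<open>Positions \<open>j\<close> in a word of length \<open>N\<close> are counted from 1.\<close>

definition in_window :: "nat \<Rightarrow> nat list \<Rightarrow> nat \<Rightarrow> nat \<Rightarrow> bool" where
  "in_window b w N j \<longleftrightarrow>
     window_lower b w * real N < real j \<and> real j \<le> window_upper b w * real N"

text \<open>The product over all \<open>w\<close> of the window functions of \<open>w\<close> (multiplication by
  \<open>exp (2 \<pi> \<i> / m)\<close> on the window of \<open>w\<close>) raised to the real powers \<open>S w\<close>.\<close>

definition window_map :: "nat \<Rightarrow> nat \<Rightarrow> weighting \<Rightarrow> complex list \<Rightarrow> complex list" where
  "window_map b m S v =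
     map (\<lambda>j. v ! (j - 1) *
            exp (2 * of_real pi * \<i> / of_nat m *
                 of_real (\<Sum>w\<in>{w \<in> support S. in_window b w (length v) j}. S w)))
         [1..<length v + 1]"

text \<open>Every \<open>u t\<close> is a prefix of \<open>a\<close>, and the lengths tend to infinity, so that every letter of
  \<open>a\<close> is determined by the words \<open>u t\<close>.\<close>

definition word_limit :: "(nat \<Rightarrow> 'a list) \<Rightarrow> (nat \<Rightarrow> 'a) \<Rightarrow> bool" where
  "word_limit u a \<longleftrightarrow>
     (\<forall>t. \<forall>j<length (u t). u t ! j = a j) \<and>
     filterlim (\<lambda>t. length (u t)) at_top sequentially"

end

(* Deleting the last digit of n removes exactly the occurrences ending at place 0, and those depend
   only on the last l digits of n. Hence the increment e(i b^L + r) - e(r) does not change when the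
   last digit is deleted from both arguments, as long as L >= l, so it depends only on i and on the
   leading l - 1 of the L digits of r. Taking this increment as the weight of the word formed by i
   followed by these l - 1 digits, exactly one window of T i contains each position r + 1. *)
theory Submission
  imports Defs
begin

section \<open>Words and their values in base \<open>b\<close>\<close>

lemma word_value_Cons: "word_value b (a # w) = a * b ^ length w + word_value b w"
  by (simp add: word_value_def sum.lessThan_Suc_shift del: sum.lessThan_Suc)

lemma word_value_less:
  assumes "word_over b w"
  shows "word_value b w < b ^ length w"
  using assms
proof (induction w)
  case Nil
  then show ?case by (simp add: word_value_def)
next
  case (Cons a w)
  then have "word_value b w < b ^ length w" "a < b"
    by (auto simp: word_over_def)
  then have "a * b ^ length w + word_value b w < Suc a * b ^ length w"
    by simp
  also have "\<dots> \<le> b * b ^ length w"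
    using \<open>a < b\<close> by (intro mult_right_mono) auto
  finally show ?case by (simp add: word_value_Cons)
qed

text \<open>The value of the tail stays below \<open>b ^ length w\<close>, so division by this power
  recovers the first letter, and induction handles the tail.\<close>

lemma word_value_inject:
  assumes "word_over b v" "word_over b w" "length v = length w"
    and "word_value b v = word_value b w"
  shows "v = w"
  using assms(3,1,2,4)
proof (induction v w rule: list_induct2)
  case Nil
  then show ?case by simp
next
  case (Cons x v y w)
  from Cons.prems have over: "word_over b v" "word_over b w"
    by (auto simp: word_over_def)
  have less: "word_value b v < b ^ length w" "word_value b w < b ^ length w"
    using word_value_less[OF over(1)] word_value_less[OF over(2)] Cons.hyps by auto
  have eq: "x * b ^ length w + word_value b v = y * b ^ length w + word_value b w"
    using Cons.prems Cons.hyps by (simp add: word_value_Cons)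
  have "x = (x * b ^ length w + word_value b v) div b ^ length w"
    using less(1) by (subst div_mult_self3) (linarith, simp)
  also have "\<dots> = y"
    using less(2) unfolding eq by (subst div_mult_self3) (linarith, simp)
  finally show ?case
    using eq Cons.IH over by simp
qed

lemma ex_word_value:
  assumes "x < b ^ p"
  shows "\<exists>w. word_over b w \<and> length w = p \<and> word_value b w = x"
  using assms
proof (induction p arbitrary: x)
  case 0
  then show ?case by (simp add: word_value_def word_over_def)
next
  case (Suc p)
  then have "b ^ p > 0"
    by (cases "b = 0") auto
  then obtain w where "word_over b w" "length w = p" "word_value b w = x mod b ^ p"
    using Suc.IH[of "x mod b ^ p"] by auto
  moreover have "x div b ^ p < b"
    using Suc.prems by (simp add: less_mult_imp_div_less)
  ultimately show ?case
    by (intro exI[of _ "x div b ^ p # w"]) (simp_all add: word_over_def word_value_Cons div_mult_mod_eq)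
qed

section \<open>Digits and occurrences under deletion of the last digit\<close>

lemma digit_Suc: "digit b n (Suc k) = digit b (n div b) k"
  by (simp add: digit_def div_mult2_eq)

lemma digit_add_power:
  assumes "b > 0" "k < L"
  shows "digit b (i * b ^ L + r) k = digit b r k"
proof -
  obtain d where L: "L = k + Suc d"
    using assms(2) less_iff_Suc_add by auto
  have "i * b ^ L + r = r + (i * b ^ d * b) * b ^ k"
    by (simp add: L power_add mult_ac)
  then have "(i * b ^ L + r) div b ^ k = i * b ^ d * b + r div b ^ k"
    using assms(1) by (simp only: div_mult_self1 zero_less_power neq0_conv)
  then show ?thesis by (simp add: digit_def)
qed

text \<open>A nonzero letter matched at place \<open>j\<close> forces \<open>b ^ j \<le> n\<close>,
  hence \<open>k \<le> j < b ^ j \<le> n\<close>. Finiteness is what lets \<open>card\<close> add up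
  over a disjoint union below.\<close>

lemma finite_occurrences:
  assumes "b > 1" "\<not> set w \<subseteq> {0}"
  shows "finite {k. \<forall>i<length w. w ! i = digit b n (k + (length w - 1 - i))}"
proof (rule finite_subset)
  show "{k. \<forall>i<length w. w ! i = digit b n (k + (length w - 1 - i))} \<subseteq> {..n}"
  proof
    fix k assume k: "k \<in> {k. \<forall>i<length w. w ! i = digit b n (k + (length w - 1 - i))}"
    obtain i where i: "i < length w" "w ! i \<noteq> 0"
      using assms(2) by (auto simp: subset_iff in_set_conv_nth)
    define j where "j = k + (length w - 1 - i)"
    have "digit b n j \<noteq> 0"
      using k i by (auto simp: j_def)
    then have "b ^ j \<le> n"
      by (metis digit_def div_less mod_0 not_le)
    moreover have "j < b ^ j"
      using assms(1) by (simp add: power_gt_expt)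
    ultimately show "k \<in> {..n}"
      by (simp add: j_def)
  qed
qed simp

lemma occurrences_div:
  assumes "b > 1" "\<not> set w \<subseteq> {0}"
  shows "occurrences b w n = occurrences b w (n div b) +
           of_bool (\<forall>i<length w. w ! i = digit b n (length w - 1 - i))"
proof -
  let ?K = "\<lambda>n. {k. \<forall>i<length w. w ! i = digit b n (k + (length w - 1 - i))}"
  let ?P = "\<forall>i<length w. w ! i = digit b n (length w - 1 - i)"
  have "digit b n (Suc k + j) = digit b (n div b) (k + j)" for k j
    by (simp add: digit_Suc)
  then have "Suc k \<in> ?K n \<longleftrightarrow> k \<in> ?K (n div b)" for k
    by (simp only: mem_Collect_eq)
  moreover have "0 \<in> ?K n \<longleftrightarrow> ?P"
    by simp
  ultimately have "k \<in> ?K n \<longleftrightarrow> k \<in> Suc ` ?K (n div b) \<union> (if ?P then {0} else {})" for k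
    by (cases k) (simp_all only: Un_iff image_iff nat.inject nat.distinct split: if_split, auto)
  then have "?K n = Suc ` ?K (n div b) \<union> (if ?P then {0} else {})"
    by blast
  moreover have "card (Suc ` ?K (n div b) \<union> (if ?P then {0} else {})) =
      card (Suc ` ?K (n div b)) + card (if ?P then {0::nat} else {})"
    using finite_occurrences[OF assms] by (intro card_Un_disjoint) auto
  ultimately show ?thesis
    by (simp add: occurrences_def card_image)
qed

text \<open>An occurrence ending at place 0 reads only places up to
  \<open>length w - 1 \<le> L\<close>, which the summand \<open>i * b ^ Suc L\<close> does not
  affect. The two place-0 terms therefore cancel in the difference.\<close>

lemma occurrences_add_power_div:
  assumes "b > 1" "\<not> set w \<subseteq> {0}" "length w \<le> Suc L"
  shows "real (occurrences b w (i * b ^ Suc L + r)) - real (occurrences b w r) =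
         real (occurrences b w (i * b ^ L + r div b)) - real (occurrences b w (r div b))"
proof -
  have "(i * b ^ Suc L + r) div b = i * b ^ L + r div b"
  proof -
    have "i * b ^ Suc L + r = r + (i * b ^ L) * b" by simp
    then show ?thesis
      using assms(1) by (simp only: div_mult_self1)
  qed
  moreover have "digit b (i * b ^ Suc L + r) (length w - 1 - j) = digit b r (length w - 1 - j)"
    if "j < length w" for j
    using that assms by (intro digit_add_power) auto
  ultimately show ?thesis
    using occurrences_div[OF assms(1,2), of "i * b ^ Suc L + r"]
      occurrences_div[OF assms(1,2), of r]
    by (simp del: power_Suc)
qed

lemma weighted_subset_support_nonzero:
  assumes "weighted_subset b S" "w \<in> support S"
  shows "\<not> set w \<subseteq> {0}"
  using assms by (auto simp: weighted_subset_def support_def)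

lemma length_le_max_length:
  assumes "weighted_subset b S" "w \<in> support S"
  shows "length w \<le> max_length S"
  using assms by (auto simp: max_length_def weighted_subset_def)

text \<open>Deletes \<open>k\<close> digits one at a time. The last deletion lowers the exponent
  from \<open>Suc p\<close> to \<open>p\<close> and needs words of length at most
  \<open>Suc p\<close>, which explains the bound \<open>max_length S - 1\<close>.\<close>

lemma weighted_occurrences_diff_reduce:
  assumes "b > 1" "weighted_subset b S" "max_length S - 1 \<le> p"
  shows "weighted_occurrences b S (i * b ^ (p + k) + r) - weighted_occurrences b S r =
         weighted_occurrences b S (i * b ^ p + r div b ^ k) - weighted_occurrences b S (r div b ^ k)"
proof (induction k arbitrary: r)
  case 0
  then show ?case by simp
next
  case (Suc k)
  have step: "real (occurrences b w (i * b ^ Suc (p + k) + r)) - real (occurrences b w r) =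
      real (occurrences b w (i * b ^ (p + k) + r div b)) - real (occurrences b w (r div b))"
    if "w \<in> support S" for w
    using that length_le_max_length[OF assms(2) that] assms
      weighted_subset_support_nonzero[OF assms(2) that]
    by (intro occurrences_add_power_div) auto
  have "weighted_occurrences b S (i * b ^ Suc (p + k) + r) - weighted_occurrences b S r =
      weighted_occurrences b S (i * b ^ (p + k) + r div b) - weighted_occurrences b S (r div b)"
    unfolding weighted_occurrences_def sum_subtractf[symmetric] right_diff_distrib[symmetric]
    by (intro sum.cong refl) (simp only: step)
  then show ?case
    using Suc.IH[of "r div b"] by (simp add: div_mult2_eq)
qed

section \<open>Windows and the weights of the sets to be constructed\<close>

text \<open>The tails of length \<open>p\<close> cut the \<open>b ^ (p + k)\<close> positions into
  \<open>b ^ p\<close> consecutive blocks of \<open>b ^ k\<close> positions each, ordered by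
  value.\<close>

lemma in_window_iff:
  assumes "b > 0" "length w = Suc p"
  shows "in_window b w (b ^ (p + k)) (Suc r) \<longleftrightarrow> r div b ^ k = word_value b (tl w)"
proof -
  let ?v = "word_value b (tl w)"
  have scale: "x / real b ^ p * real (b ^ (p + k)) = x * real (b ^ k)" for x
    using assms(1) by (simp add: power_add)
  have "in_window b w (b ^ (p + k)) (Suc r) \<longleftrightarrow>
      real (?v * b ^ k) < real (Suc r) \<and> real (Suc r) \<le> real (Suc ?v * b ^ k)"
    unfolding in_window_def window_lower_def window_upper_def assms(2) diff_Suc_1 scale
    by (simp add: distrib_right add.commute)
  \<comment> \<open>Passing from the 1-based position \<open>Suc r\<close> to the index
    \<open>r\<close> turns the window, open on the left, into an interval open on the right.\<close>
  also have "\<dots> \<longleftrightarrow> ?v * b ^ k \<le> r \<and> r < Suc ?v * b ^ k"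
    by (simp only: of_nat_less_iff of_nat_le_iff) linarith
  also have "\<dots> \<longleftrightarrow> r div b ^ k = ?v"
    using assms(1)
    by (simp only: less_eq_div_iff_mult_less_eq[symmetric] div_less_iff_less_mult[symmetric]
        zero_less_power) linarith
  finally show ?thesis .
qed

text \<open>For \<open>w = i # v\<close> the first value is
  \<open>i * b ^ p + word_value b v\<close>, so the weight is the increment at exponent
  \<open>p\<close>. Fixing both length and head makes the windows of distinct words disjoint; a head
  \<open>i \<noteq> 0\<close> gives properness.\<close>

definition increment_weight :: "nat \<Rightarrow> weighting \<Rightarrow> nat \<Rightarrow> nat \<Rightarrow> weighting" where
  "increment_weight b S p i w =
     (if length w = Suc p \<and> word_over b w \<and> hd w = i
      then weighted_occurrences b S (word_value b w) - weighted_occurrences b S (word_value b (tl w))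
      else 0)"

lemma support_increment_weight:
  "support (increment_weight b S p i) \<subseteq> {w. length w = Suc p \<and> word_over b w \<and> hd w = i}"
  by (auto simp: support_def increment_weight_def split: if_splits)

lemma finite_support_increment_weight: "finite (support (increment_weight b S p i))"
proof (rule finite_subset)
  show "support (increment_weight b S p i) \<subseteq> {w. set w \<subseteq> {..<b} \<and> length w = Suc p}"
    using support_increment_weight by (force simp: word_over_def)
qed (simp add: finite_lists_length_eq)

lemma weighted_subset_increment_weight:
  assumes "i \<noteq> 0"
  shows "weighted_subset b (increment_weight b S p i)"
  unfolding weighted_subset_def
proof (intro conjI ballI allI impI)
  fix w :: "nat list" assume "set w \<subseteq> {0}"
  then show "increment_weight b S p i w = 0"
    using assms by (cases w) (auto simp: increment_weight_def)
qed (use support_increment_weight finite_support_increment_weight in blast)+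

lemma proper_increment_weight:
  assumes "i \<noteq> 0"
  shows "proper (increment_weight b S p i)"
  using support_increment_weight assms unfolding proper_def by blast

text \<open>The only word that can contribute is \<open>i\<close> followed by the leading
  \<open>p\<close> of the \<open>p + k\<close> digits of \<open>r\<close>; its weight equals the
  increment at \<open>r\<close> because deleting the other \<open>k\<close> digits preserves
  increments.\<close>

lemma sum_increment_weight:
  assumes "b > 1" "weighted_subset b S" "max_length S - 1 \<le> p" "i < b" "r < b ^ (p + k)"
  shows "(\<Sum>w | w \<in> support (increment_weight b S p i) \<and> in_window b w (b ^ (p + k)) (Suc r).
            increment_weight b S p i w) =
         weighted_occurrences b S (i * b ^ (p + k) + r) - weighted_occurrences b S r"
proof -
  let ?x = "r div b ^ k" and ?T = "increment_weight b S p i"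
  have "?x < b ^ p"
    using assms(5) by (simp add: less_mult_imp_div_less power_add)
  then obtain v where v: "word_over b v" "length v = p" "word_value b v = ?x"
    using ex_word_value by blast
  have unique: "w = i # v" if "w \<in> support ?T" "in_window b w (b ^ (p + k)) (Suc r)" for w
  proof -
    have w: "length w = Suc p" "word_over b w" "hd w = i"
      using that(1) support_increment_weight by blast+
    then have "word_value b (tl w) = word_value b v"
      using that(2) in_window_iff[of b w p k r] assms(1) v by simp
    moreover have "word_over b (tl w)"
      using w by (cases w) (auto simp: word_over_def)
    ultimately have "tl w = v"
      using v w by (intro word_value_inject) auto
    then show ?thesis
      using w by (cases w) auto
  qed
  have window: "in_window b (i # v) (b ^ (p + k)) (Suc r)"
    using in_window_iff[of b "i # v" p k r] assms(1) v by simp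
  \<comment> \<open>The word \<open>i # v\<close> may have weight 0 and then lies outside the
    support, so the index sets need not be equal, only the sums.\<close>
  have "(\<Sum>w | w \<in> support ?T \<and> in_window b w (b ^ (p + k)) (Suc r). ?T w) = (\<Sum>w\<in>{i # v}. ?T w)"
    by (rule sum.mono_neutral_left) (use unique window in \<open>auto simp: support_def\<close>)
  also have "\<dots> = weighted_occurrences b S (i * b ^ p + ?x) - weighted_occurrences b S ?x"
    using v assms(4) by (simp add: increment_weight_def word_over_def word_value_Cons)
  also have "\<dots> = weighted_occurrences b S (i * b ^ (p + k) + r) - weighted_occurrences b S r"
    using weighted_occurrences_diff_reduce[OF assms(1-3), of i k r] by simp
  finally show ?thesis .
qed

section \<open>The recursion for the prefixes of the sequence\<close>

text \<open>At index \<open>r\<close> the window weights add the increment to the exponent, turning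
  the letter at \<open>r\<close> into the letter at \<open>i * b ^ L + r\<close>.\<close>

lemma window_map_block_seq:
  assumes "b > 1" "weighted_subset b S" "max_length S - 1 \<le> p" "i < b" "p \<le> L"
  shows "window_map b m (increment_weight b S p i) (map (block_seq b m S) [0..<b ^ L]) =
         map (block_seq b m S) [i * b ^ L..<Suc i * b ^ L]"
proof (rule nth_equalityI)
  fix r
  assume "r < length (window_map b m (increment_weight b S p i)
                         (map (block_seq b m S) [0..<b ^ L]))"
  then have r: "r < b ^ L"
    by (simp add: window_map_def del: upt_Suc)
  obtain k where L: "L = p + k"
    using assms(5) le_Suc_ex by blast
  have "window_map b m (increment_weight b S p i) (map (block_seq b m S) [0..<b ^ L]) ! r =
      block_seq b m S r * exp (2 * of_real pi * \<i> / of_nat m *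
        of_real (weighted_occurrences b S (i * b ^ L + r) - weighted_occurrences b S r))"
    using r sum_increment_weight[OF assms(1-4), of r k]
    by (simp add: window_map_def L del: upt_Suc of_real_sum of_real_diff)
  also have "\<dots> = block_seq b m S (i * b ^ L + r)"
    unfolding block_seq_def exp_add[symmetric]
    by (rule arg_cong[of _ _ exp]) (simp add: algebra_simps diff_divide_distrib)
  finally show "window_map b m (increment_weight b S p i) (map (block_seq b m S) [0..<b ^ L]) ! r =
      map (block_seq b m S) [i * b ^ L..<Suc i * b ^ L] ! r"
    using r by simp
qed (simp add: window_map_def del: upt_Suc)

lemma concat_upt_blocks:
  "concat (map (\<lambda>i. map f [i * N..<Suc i * N]) [0..<c]) = map f [0..<c * N]"
proof (induction c)
  case (Suc c)
  have "[0..<Suc c * N] = [0..<c * N] @ [c * N..<Suc c * N]"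
    using upt_add_eq_append[of 0 "c * N" N] by (simp add: add.commute)
  then show ?case
    using Suc by simp
qed simp

theorem theorem3:
  fixes b m :: nat and S :: weighting
  assumes "b > 1" and "m > 1"
    and "weighted_subset b S"
  shows "\<exists>(T :: nat \<Rightarrow> weighting) (u :: nat \<Rightarrow> complex list).
           (\<forall>i\<in>{1..b - 1}. weighted_subset b (T i) \<and> proper (T i)) \<and>
           length (u 0) = b ^ max_length S \<and>
           (\<forall>t. u (Suc t) = u t @ concat (map (\<lambda>i. window_map b m (T i) (u t)) [1..<b])) \<and>
           word_limit u (block_seq b m S)"
proof -
  define l where "l = max_length S"
  \<comment> \<open>The words used have length \<open>l\<close> if \<open>l > 0\<close>. If
    \<open>l = 0\<close>, truncated subtraction gives length 1, and all weights vanish.\<close>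
  define T where "T = increment_weight b S (l - 1)"
  \<comment> \<open>Prefixes of length a power of \<open>b\<close> split into \<open>b\<close> equal
    blocks, one for each leading digit; the exponent \<open>l + t\<close> is at least
    \<open>l - 1\<close>, as the windows require.\<close>
  define u where "u t = map (block_seq b m S) [0..<b ^ (l + t)]" for t
  have "u (Suc t) = u t @ concat (map (\<lambda>i. window_map b m (T i) (u t)) [1..<b])" for t
  proof -
    let ?B = "\<lambda>i. map (block_seq b m S) [i * b ^ (l + t)..<Suc i * b ^ (l + t)]"
    have "u (Suc t) = concat (map ?B [0..<b])"
      unfolding concat_upt_blocks by (simp add: u_def)
    \<comment> \<open>The block for leading digit 0 is \<open>u t\<close> itself.\<close>
    also have "\<dots> = u t @ concat (map ?B [1..<b])"
      using assms(1) by (simp add: upt_conv_Cons u_def)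
    also have "map ?B [1..<b] = map (\<lambda>i. window_map b m (T i) (u t)) [1..<b]"
      unfolding T_def u_def
      by (rule map_cong[OF refl], rule window_map_block_seq[symmetric])
        (use assms in \<open>auto simp: l_def\<close>)
    finally show ?thesis .
  qed
  moreover have "word_limit u (block_seq b m S)"
    unfolding word_limit_def
  proof (intro conjI allI impI)
    show "filterlim (\<lambda>t. length (u t)) at_top sequentially"
    proof (rule filterlim_at_top_mono[OF filterlim_ident])
      have "t \<le> length (u t)" for t
      proof -
        have "l + t < b ^ (l + t)"
          using assms(1) by (simp add: power_gt_expt)
        then show ?thesis by (simp add: u_def)
      qed
      then show "\<forall>\<^sub>F t in sequentially. t \<le> length (u t)"
        by simp
    qed
  qed (simp add: u_def)
  moreover have "\<forall>i\<in>{1..b - 1}. weighted_subset b (T i) \<and> proper (T i)"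
    unfolding T_def by (auto intro: weighted_subset_increment_weight proper_increment_weight)
  moreover have "length (u 0) = b ^ max_length S"
    by (simp add: u_def l_def)
  ultimately show ?thesis by blast
qed

end
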